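(* Let $X$ be a fuzzy topological space. If $\bigwedge_{A\in\Gamma}wcl(A)\neq0_X$ for every fuzzy filterbase $\Gamma$ in $X$, then $X$ is fuzzy weakly-compact.
   Context: Fuzzy topological spaces (FTS) are in Chang's sense: a fuzzy set in $X$ is a function $X\to[0,1]$, ordered pointwise by $\leq$, with $\vee,\wedge$ pointwise supremum and infimum and complement $A^c=1-A$; $0_X,1_X$ are the constant functions. A fuzzy topology $\tau$ on $X$ is a family of fuzzy sets containing $0_X,1_X$ and closed under finite $\wedge$ and arbitrary $\bigvee$; members of $\tau$ are fuzzy open and their complements fuzzy closed. $cl(A)$ is the infimum of all fuzzy closed sets $\geq A$ and $int(A)$ is the supremum of all fuzzy open sets $\leq A$. A fuzzy set $A$ is fuzzy semi-closed if $int(cl(A))\leq A$; a fuzzy set is fuzzy semi-open if its complement is fuzzy semi-closed. A fuzzy set $A$ is fuzzy weakly-closed if $cl(A)\leq U$ for every fuzzy semi-open set $U$ with $A\leq U$. A fuzzy set is fuzzy weakly-open if its complement is fuzzy weakly-closed. The fuzzy weakly-closure of $A$ is $wcl(A)=\bigwedge\{B\mid B\text{ is fuzzy weakly-closed and }A\leq B\}$. A collection $\Gamma$ of fuzzy sets in $X$ is a fuzzy filterbase if $\bigwedge_{j=1}^nA_j\neq0_X$ for every finite subcollection $\{A_1,\dots,A_n\}$ of $\Gamma$. $X$ is fuzzy weakly-compact if every family $\{G_\lambda\mid\lambda\in\Lambda\}$ of fuzzy weakly-open sets with $\bigvee_{\lambda\in\Lambda}G_\lambda=1_X$ has a finite subfamily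 $G_{\lambda_1},\dots,G_{\lambda_n}$ with $\bigvee_{i=1}^nG_{\lambda_i}=1_X$. *)

theory Defs
  imports Complex_Main
begin

text \<open>
  The closed unit interval as a complete linear order, so that fuzzy sets
  \<^typ>\<open>'a \<Rightarrow> real\<close> with values in $[0,1]$ become functions into this type and inherit
  from the library the pointwise order, the pointwise (arbitrary) suprema and infima,
  and \<^const>\<open>bot\<close>, \<^const>\<open>top\<close> as the constant functions $0_X$, $1_X$.
\<close>

typedef unit_interval = "{0..1::real}"
  morphisms real_of_unit Unit
  by (rule exI[of _ 0]) simp

setup_lifting type_definition_unit_interval

instantiation unit_interval :: linorder
begin

lift_definition less_eq_unit_interval :: "unit_interval \<Rightarrow> unit_interval \<Rightarrow> bool" is "(\<le>)" .
lift_definition less_unit_interval :: "unit_interval \<Rightarrow> unit_interval \<Rightarrow> bool" is "(<)" .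

instance by standard (transfer; auto)+

end

instantiation unit_interval :: complete_linorder
begin

lift_definition bot_unit_interval :: unit_interval is 0 by simp
lift_definition top_unit_interval :: unit_interval is 1 by simp
lift_definition inf_unit_interval :: "unit_interval \<Rightarrow> unit_interval \<Rightarrow> unit_interval" is min by auto
lift_definition sup_unit_interval :: "unit_interval \<Rightarrow> unit_interval \<Rightarrow> unit_interval" is max by auto

text \<open>The empty set needs separate treatment because \<^const>\<open>Sup\<close> and \<^const>\<open>Inf\<close> of the empty
  set of reals are unspecified.\<close>

lift_definition Sup_unit_interval :: "unit_interval set \<Rightarrow> unit_interval"
  is "\<lambda>S. if S = {} then 0 else Sup S"
proof -
  fix S :: "real set" assume "\<And>x. x \<in> S \<Longrightarrow> x \<in> {0..1}"
  then have S: "S \<subseteq> {0..1}" by blast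
  show "(if S = {} then 0 else Sup S) \<in> {0..1}"
  proof (cases "S = {}")
    case False
    then obtain s where s: "s \<in> S" by blast
    have "bdd_above S" using S by (meson bdd_above_Icc bdd_above_mono)
    then have "s \<le> Sup S" using s by (rule cSup_upper[rotated])
    moreover have "0 \<le> s" using s S by auto
    moreover have "Sup S \<le> 1" using False S by (intro cSup_least) auto
    ultimately show ?thesis using False by auto
  qed simp
qed

lift_definition Inf_unit_interval :: "unit_interval set \<Rightarrow> unit_interval"
  is "\<lambda>S. if S = {} then 1 else Inf S"
proof -
  fix S :: "real set" assume "\<And>x. x \<in> S \<Longrightarrow> x \<in> {0..1}"
  then have S: "S \<subseteq> {0..1}" by blast
  show "(if S = {} then 1 else Inf S) \<in> {0..1}"
  proof (cases "S = {}")
    case False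
    then obtain s where s: "s \<in> S" by blast
    have "bdd_below S" using S by (meson bdd_below_Icc bdd_below_mono)
    then have "Inf S \<le> s" using s by (rule cInf_lower[rotated])
    moreover have "s \<le> 1" using s S by auto
    moreover have "0 \<le> Inf S" using False S by (intro cInf_greatest) auto
    ultimately show ?thesis using False by auto
  qed simp
qed

instance
proof
  have bdd: "bdd_above (real_of_unit ` S)" "bdd_below (real_of_unit ` S)" for S
    using real_of_unit by (auto intro!: bdd_aboveI[of _ 1] bdd_belowI[of _ 0])
  fix x y z :: unit_interval and A :: "unit_interval set"
  show "inf x y \<le> x" "inf x y \<le> y" "x \<le> sup x y" "y \<le> sup x y"
    by (transfer; simp)+
  show "x \<le> y \<Longrightarrow> x \<le> z \<Longrightarrow> x \<le> inf y z" by transfer simp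
  show "y \<le> x \<Longrightarrow> z \<le> x \<Longrightarrow> sup y z \<le> x" by transfer simp
  show "x \<in> A \<Longrightarrow> Inf A \<le> x"
    using bdd[of A] by (auto simp: less_eq_unit_interval.rep_eq Inf_unit_interval.rep_eq
        intro: cInf_lower)
  show "x \<in> A \<Longrightarrow> x \<le> Sup A"
    using bdd[of A] by (auto simp: less_eq_unit_interval.rep_eq Sup_unit_interval.rep_eq
        intro: cSup_upper)
  show "(\<And>x. x \<in> A \<Longrightarrow> z \<le> x) \<Longrightarrow> z \<le> Inf A"
    using real_of_unit[of z] by (auto simp: less_eq_unit_interval.rep_eq
        Inf_unit_interval.rep_eq intro!: cInf_greatest)
  show "(\<And>x. x \<in> A \<Longrightarrow> x \<le> z) \<Longrightarrow> Sup A \<le> z"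
    using real_of_unit[of z] by (auto simp: less_eq_unit_interval.rep_eq
        Sup_unit_interval.rep_eq intro!: cSup_least)
  show "Inf {} = (top :: unit_interval)" by transfer simp
  show "Sup {} = (bot :: unit_interval)" by transfer simp
qed

end

lift_definition unit_compl :: "unit_interval \<Rightarrow> unit_interval" is "\<lambda>x. 1 - x" by auto

type_synonym 'a fuzzy = "'a \<Rightarrow> unit_interval"

definition fuzzy_compl :: "'a fuzzy \<Rightarrow> 'a fuzzy" where
  "fuzzy_compl A = (\<lambda>x. unit_compl (A x))"

text \<open>The ground set of the space is the type \<^typ>\<open>'a\<close>; closure under finite meets is
  expressed by \<^term>\<open>top \<in> \<tau>\<close> and binary meets.\<close>

definition fuzzy_topology :: "'a fuzzy set \<Rightarrow> bool" where
  "fuzzy_topology \<tau> \<longleftrightarrow>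
     bot \<in> \<tau> \<and> top \<in> \<tau> \<and>
     (\<forall>A\<in>\<tau>. \<forall>B\<in>\<tau>. inf A B \<in> \<tau>) \<and>
     (\<forall>F. F \<subseteq> \<tau> \<longrightarrow> Sup F \<in> \<tau>)"

definition fuzzy_open :: "'a fuzzy set \<Rightarrow> 'a fuzzy \<Rightarrow> bool" where
  "fuzzy_open \<tau> A \<longleftrightarrow> A \<in> \<tau>"

definition fuzzy_closed :: "'a fuzzy set \<Rightarrow> 'a fuzzy \<Rightarrow> bool" where
  "fuzzy_closed \<tau> A \<longleftrightarrow> (\<exists>U. fuzzy_open \<tau> U \<and> A = fuzzy_compl U)"

definition fuzzy_cl :: "'a fuzzy set \<Rightarrow> 'a fuzzy \<Rightarrow> 'a fuzzy" where
  "fuzzy_cl \<tau> A = Inf {C. fuzzy_closed \<tau> C \<and> A \<le> C}"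

definition fuzzy_int :: "'a fuzzy set \<Rightarrow> 'a fuzzy \<Rightarrow> 'a fuzzy" where
  "fuzzy_int \<tau> A = Sup {U. fuzzy_open \<tau> U \<and> U \<le> A}"

definition fuzzy_semi_closed :: "'a fuzzy set \<Rightarrow> 'a fuzzy \<Rightarrow> bool" where
  "fuzzy_semi_closed \<tau> A \<longleftrightarrow> fuzzy_int \<tau> (fuzzy_cl \<tau> A) \<le> A"

definition fuzzy_semi_open :: "'a fuzzy set \<Rightarrow> 'a fuzzy \<Rightarrow> bool" where
  "fuzzy_semi_open \<tau> A \<longleftrightarrow> fuzzy_semi_closed \<tau> (fuzzy_compl A)"

definition fuzzy_weakly_closed :: "'a fuzzy set \<Rightarrow> 'a fuzzy \<Rightarrow> bool" where
  "fuzzy_weakly_closed \<tau> A \<longleftrightarrow>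
     (\<forall>U. fuzzy_semi_open \<tau> U \<and> A \<le> U \<longrightarrow> fuzzy_cl \<tau> A \<le> U)"

definition fuzzy_weakly_open :: "'a fuzzy set \<Rightarrow> 'a fuzzy \<Rightarrow> bool" where
  "fuzzy_weakly_open \<tau> A \<longleftrightarrow> fuzzy_weakly_closed \<tau> (fuzzy_compl A)"

definition fuzzy_wcl :: "'a fuzzy set \<Rightarrow> 'a fuzzy \<Rightarrow> 'a fuzzy" where
  "fuzzy_wcl \<tau> A = Inf {B. fuzzy_weakly_closed \<tau> B \<and> A \<le> B}"

text \<open>In the next two definitions the empty finite subcollection is harmless:
  \<^term>\<open>Inf {} = (top :: 'a fuzzy)\<close> and \<^term>\<open>Sup {} = (bot :: 'a fuzzy)\<close> are distinct.\<close>

definition fuzzy_filterbase :: "'a fuzzy set \<Rightarrow> bool" where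
  "fuzzy_filterbase \<Gamma> \<longleftrightarrow> (\<forall>F. finite F \<and> F \<subseteq> \<Gamma> \<longrightarrow> Inf F \<noteq> bot)"

definition fuzzy_weakly_compact :: "'a fuzzy set \<Rightarrow> bool" where
  "fuzzy_weakly_compact \<tau> \<longleftrightarrow>
     (\<forall>\<G>. (\<forall>G\<in>\<G>. fuzzy_weakly_open \<tau> G) \<and> Sup \<G> = top \<longrightarrow>
        (\<exists>F. finite F \<and> F \<subseteq> \<G> \<and> Sup F = top))"

end

theory Submission
  imports Defs
begin

text \<open>
  If a weakly-open cover had no finite subcover, the complements of its members would form a
  filterbase of weakly-closed sets. The weakly-closure of a weakly-closed set is below the set
  itself, so the meet of these closures is below the complement of the join of the cover, which
  is $0_X$.
\<close>

lemma unit_compl_unit_compl [simp]: "unit_compl (unit_compl x) = x"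
  by transfer simp

lemma unit_compl_le_iff [simp]: "unit_compl x \<le> unit_compl y \<longleftrightarrow> y \<le> x"
  by transfer auto

lemma fuzzy_compl_fuzzy_compl [simp]: "fuzzy_compl (fuzzy_compl A) = A"
  by (simp add: fuzzy_compl_def)

lemma fuzzy_compl_le_iff [simp]: "fuzzy_compl A \<le> fuzzy_compl B \<longleftrightarrow> B \<le> A"
  by (simp add: fuzzy_compl_def le_fun_def)

text \<open>Complementation is an antitone involution, hence self-adjoint; this swap spares
  pointwise computations with suprema and infima.\<close>

lemma le_fuzzy_compl_iff: "A \<le> fuzzy_compl B \<longleftrightarrow> B \<le> fuzzy_compl A"
  using fuzzy_compl_le_iff[of "fuzzy_compl A" B] by simp

lemma fuzzy_compl_top [simp]: "fuzzy_compl top = bot"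
  by (rule bot_unique[THEN iffD1]) (metis fuzzy_compl_fuzzy_compl fuzzy_compl_le_iff top_greatest)

lemma fuzzy_compl_bot [simp]: "fuzzy_compl bot = top"
  using fuzzy_compl_fuzzy_compl[of top] by simp

text \<open>De Morgan: one inequality is antitonicity; for the other, the swap moves the complement
  off the join, leaving a bound to check on each member.\<close>

lemma fuzzy_compl_Sup: "fuzzy_compl (Sup \<G>) = Inf (fuzzy_compl ` \<G>)"
proof (rule order.antisym)
  show "fuzzy_compl (Sup \<G>) \<le> Inf (fuzzy_compl ` \<G>)"
    by (auto intro!: INF_greatest Sup_upper)
  have "Sup \<G> \<le> fuzzy_compl (Inf (fuzzy_compl ` \<G>))"
    by (rule Sup_least) (rule le_fuzzy_compl_iff[THEN iffD1], rule INF_lower)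
  then show "Inf (fuzzy_compl ` \<G>) \<le> fuzzy_compl (Sup \<G>)"
    by (rule le_fuzzy_compl_iff[THEN iffD1])
qed

lemma fuzzy_wcl_le: "fuzzy_weakly_closed \<tau> B \<Longrightarrow> fuzzy_wcl \<tau> B \<le> B"
  by (auto simp: fuzzy_wcl_def intro: Inf_lower)

theorem theorem4p6:
  fixes \<tau> :: "('a \<Rightarrow> unit_interval) set"
  assumes "fuzzy_topology \<tau>"
    and "\<And>\<Gamma>. fuzzy_filterbase \<Gamma> \<Longrightarrow> (INF A\<in>\<Gamma>. fuzzy_wcl \<tau> A) \<noteq> bot"
  shows "fuzzy_weakly_compact \<tau>"
  unfolding fuzzy_weakly_compact_def
proof (intro allI impI)
  fix \<G> :: "'a fuzzy set"
  assume \<G>: "(\<forall>G\<in>\<G>. fuzzy_weakly_open \<tau> G) \<and> Sup \<G> = top"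
  let ?\<Gamma> = "fuzzy_compl ` \<G>"
  have "(INF A\<in>?\<Gamma>. fuzzy_wcl \<tau> A) \<le> (INF A\<in>?\<Gamma>. A)"
    using \<G> by (intro INF_mono) (auto simp: fuzzy_weakly_open_def intro: fuzzy_wcl_le)
  also have "\<dots> = bot"
    using \<G> fuzzy_compl_Sup[of \<G>] by simp
  finally have "\<not> fuzzy_filterbase ?\<Gamma>"
    using assms(2) bot_unique by blast
  \<comment> \<open>A finite subcollection of an image is the image of a finite subcollection, so
    the vanishing meet already comes from finitely many members of the cover.\<close>
  then obtain F where F: "finite F" "F \<subseteq> \<G>" "Inf (fuzzy_compl ` F) = bot"
    unfolding fuzzy_filterbase_def by (metis finite_subset_image)
  then have "Sup F = top"
    by (metis fuzzy_compl_Sup fuzzy_compl_bot fuzzy_compl_fuzzy_compl)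
  with F show "\<exists>F. finite F \<and> F \<subseteq> \<G> \<and> Sup F = top"
    by blast
qed

end
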